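(* Let $A_1,\dots,A_n$ be subsets of $\mathbb{R}^+$ that are strongly porous at $0$. Then the union $\bigcup_{j=1}^{n} A_j$ is strongly porous at $0$ if and only if the family $\{A_1,\dots,A_n\}$ is coherently porous.
   Context: $\mathbb{R}^+=[0,\infty)$. For $E\subseteq\mathbb{R}^+$ and $h>0$, $\lambda(E,h)$ denotes the length of the largest open subinterval of $(0,h)$ that contains no point of $E$ (and $\lambda(E,h)=0$ if there is no such nonempty interval). The right upper porosity of $E$ at $0$ is $\overline{p}(E)=\limsup_{h\to 0^+}\frac{\lambda(E,h)}{h}$. The set $E$ is strongly porous at $0$ if $\overline{p}(E)=1$. For $E\subseteq\mathbb{R}^+$, $UMP(E)$ is the set of all sequences $(h_n)_{n\in\mathbb{N}}$ of positive real numbers with $\lim_{n\to\infty}h_n=0$ and $\overline{p}(E)=\lim_{n\to\infty}\frac{\lambda(E,h_n)}{h_n}$. A family $\{A_i: i\in I\}$ of subsets of $\mathbb{R}^+$ is coherently porous if $\bigcap_{i\in I}UMP(A_i)\neq\varnothing$. *)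

theory Defs
  imports Complex_Main "HOL-Library.Extended_Real"
begin

(* The lengths in question are bounded by h, and a largest interval exists whenever a nonempty
   one does, so the supremum is the maximal length.  The inserted 0 is the value prescribed when
   there is no nonempty interval. *)
definition gap_length :: "real set \<Rightarrow> real \<Rightarrow> real" where
  "gap_length E h =
     Sup (insert 0 {b - a | a b. a < b \<and> {a<..<b} \<subseteq> {0<..<h} \<and> {a<..<b} \<inter> E = {}})"

definition upper_porosity :: "real set \<Rightarrow> ereal" where
  "upper_porosity E = Limsup (at_right 0) (\<lambda>h. ereal (gap_length E h / h))"

definition strongly_porous :: "real set \<Rightarrow> bool" where
  "strongly_porous E \<longleftrightarrow> upper_porosity E = 1"

definition UMP :: "real set \<Rightarrow> (nat \<Rightarrow> real) set" where
  "UMP E = {h. (\<forall>n. 0 < h n) \<and> h \<longlonglongrightarrow> 0 \<and>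
               (\<lambda>n. ereal (gap_length E (h n) / h n)) \<longlonglongrightarrow> upper_porosity E}"

definition coherently_porous :: "'i set \<Rightarrow> ('i \<Rightarrow> real set) \<Rightarrow> bool" where
  "coherently_porous I A \<longleftrightarrow> (\<Inter>i\<in>I. UMP (A i)) \<noteq> {}"

end

theory Submission imports Defs begin

text \<open>
  Within \<open>(0, h)\<close> an interval of length \<open>g\<close> leaves out only length \<open>h - g\<close>, so gaps of \<open>A\<close> and
  \<open>B\<close> with lengths \<open>g\<close> and \<open>g'\<close> overlap in an interval of length at least \<open>g + g' - h\<close>, and the
  overlap is a gap of \<open>A \<union> B\<close> (\<open>gap_length_Un\<close>).  Hence if the relative gap lengths of finitely
  many sets all tend to 1 along one sequence of scales, so does that of their union
  (\<open>full_gaps_UN\<close>).  Conversely a gap of the union is a gap of each member, so a sequence along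
  which the union has relative gap length tending to 1 works for every member at once.  What links
  this with porosity is that the relative gap length never exceeds 1, so that strong porosity
  means that the value 1 is approached along some sequence of scales
  (\<open>strongly_porous_iff_full_gaps\<close>).
\<close>

lemma gap_length_upper:
  assumes "0 \<le> a" "a < b" "b \<le> h" "{a<..<b} \<inter> E = {}"
  shows "b - a \<le> gap_length E h"
  unfolding gap_length_def
proof (rule cSup_upper)
  show "b - a \<in> insert 0 {b - a |a b. a < b \<and> {a<..<b} \<subseteq> {0<..<h} \<and> {a<..<b} \<inter> E = {}}"
    using assms by (auto simp: greaterThanLessThan_subseteq_greaterThanLessThan)
  show "bdd_above (insert 0 {b - a |a b. a < b \<and> {a<..<b} \<subseteq> {0<..<h} \<and> {a<..<b} \<inter> E = {}})"
    by (rule bdd_aboveI[of _ "max 0 h"])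
       (auto simp: greaterThanLessThan_subseteq_greaterThanLessThan)
qed

lemma gap_length_nonneg: "0 \<le> gap_length E h"
  unfolding gap_length_def
proof (rule cSup_upper)
  show "bdd_above (insert 0 {b - a |a b. a < b \<and> {a<..<b} \<subseteq> {0<..<h} \<and> {a<..<b} \<inter> E = {}})"
    by (rule bdd_aboveI[of _ "max 0 h"])
       (auto simp: greaterThanLessThan_subseteq_greaterThanLessThan)
qed simp

lemma gap_length_least:
  assumes "0 \<le> c"
    and "\<And>a b. \<lbrakk>0 \<le> a; a < b; b \<le> h; {a<..<b} \<inter> E = {}\<rbrakk> \<Longrightarrow> b - a \<le> c"
  shows "gap_length E h \<le> c"
  unfolding gap_length_def
  by (rule cSup_least) (use assms in \<open>auto simp: greaterThanLessThan_subseteq_greaterThanLessThan\<close>)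

lemma gap_length_le_scale: "0 \<le> h \<Longrightarrow> gap_length E h \<le> h"
  by (rule gap_length_least) auto

lemma gap_length_antimono:
  assumes "E \<subseteq> F"
  shows "gap_length F h \<le> gap_length E h"
proof (rule gap_length_least[OF gap_length_nonneg])
  fix a b assume "0 \<le> a" "a < b" "b \<le> h" "{a<..<b} \<inter> F = {}"
  with assms show "b - a \<le> gap_length E h"
    by (intro gap_length_upper) auto
qed

text \<open>
  Inside \<open>(0, h)\<close> the parts missed by two intervals have total length at most
  \<open>(h - g) + (h - g')\<close>, which bounds what their intersection misses.
\<close>

lemma gap_length_Un:
  assumes "0 \<le> h"
  shows "gap_length A h + gap_length B h - h \<le> gap_length (A \<union> B) h"
proof -
  have overlap: "b - a \<le> gap_length (A \<union> B) h + h - (d - c)"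
    if A: "0 \<le> a" "a < b" "b \<le> h" "{a<..<b} \<inter> A = {}"
      and B: "0 \<le> c" "c < d" "d \<le> h" "{c<..<d} \<inter> B = {}" for a b c d
  proof (cases "max a c < min b d")
    case True
    have "{max a c<..<min b d} \<inter> (A \<union> B) = {}"
      using A(4) B(4) by auto
    with True A B have "min b d - max a c \<le> gap_length (A \<union> B) h"
      by (intro gap_length_upper) auto
    with A B show ?thesis by linarith
  next
    case False
    with A B gap_length_nonneg[of "A \<union> B" h] show ?thesis by linarith
  qed
  have "gap_length A h \<le> gap_length (A \<union> B) h + h - gap_length B h"
  proof (rule gap_length_least)
    show "0 \<le> gap_length (A \<union> B) h + h - gap_length B h"
      using gap_length_nonneg[of "A \<union> B" h] gap_length_le_scale[OF assms, of B] by linarith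
    fix a b assume gap: "0 \<le> a" "a < b" "b \<le> h" "{a<..<b} \<inter> A = {}"
    have "gap_length B h \<le> gap_length (A \<union> B) h + h - (b - a)"
    proof (rule gap_length_least)
      show "0 \<le> gap_length (A \<union> B) h + h - (b - a)"
        using gap gap_length_nonneg[of "A \<union> B" h] by linarith
      show "d - c \<le> gap_length (A \<union> B) h + h - (b - a)"
        if "0 \<le> c" "c < d" "d \<le> h" "{c<..<d} \<inter> B = {}" for c d
        using overlap[OF gap that] by linarith
    qed
    then show "b - a \<le> gap_length (A \<union> B) h + h - gap_length B h" by linarith
  qed
  then show ?thesis by linarith
qed

text \<open>
  This is membership of \<open>h\<close> in \<open>UMP E\<close> with the limit fixed as 1 instead of the porosity of \<open>E\<close>,
  so that it can be compared between sets and passed to unions before anything is known about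
  the porosity of the union.
\<close>

definition full_gaps :: "real set \<Rightarrow> (nat \<Rightarrow> real) \<Rightarrow> bool" where
  "full_gaps E h \<longleftrightarrow>
     (\<forall>n. 0 < h n) \<and> h \<longlonglongrightarrow> 0 \<and> (\<lambda>n. gap_length E (h n) / h n) \<longlonglongrightarrow> 1"

lemma full_gapsD:
  assumes "full_gaps E h"
  shows "0 < h n" "h \<longlonglongrightarrow> 0" "(\<lambda>n. gap_length E (h n) / h n) \<longlonglongrightarrow> 1"
  using assms by (auto simp: full_gaps_def)

text \<open>
  The relative gap length is at most 1, so a lower bound tending to 1 determines its limit.
\<close>

lemma full_gaps_from_lower_bound:
  assumes "\<And>n. 0 < h n" "h \<longlonglongrightarrow> 0" "g \<longlonglongrightarrow> 1"
    and "\<And>n. g n \<le> gap_length E (h n) / h n"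
  shows "full_gaps E h"
proof -
  have "(\<lambda>n. gap_length E (h n) / h n) \<longlonglongrightarrow> 1"
  proof (rule tendsto_sandwich[OF _ _ assms(3) tendsto_const])
    show "\<forall>\<^sub>F n in sequentially. g n \<le> gap_length E (h n) / h n"
      using assms(4) by simp
    show "\<forall>\<^sub>F n in sequentially. gap_length E (h n) / h n \<le> 1"
      using assms(1) by (simp add: gap_length_le_scale less_imp_le)
  qed
  with assms show ?thesis by (simp add: full_gaps_def)
qed

lemma full_gaps_subset:
  assumes "E \<subseteq> F" "full_gaps F h"
  shows "full_gaps E h"
  by (rule full_gaps_from_lower_bound[OF full_gapsD[OF assms(2)]])
     (intro divide_right_mono gap_length_antimono assms less_imp_le full_gapsD(1)[OF assms(2)])

lemma full_gaps_Un:
  assumes A: "full_gaps A h" and B: "full_gaps B h"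
  shows "full_gaps (A \<union> B) h"
proof (rule full_gaps_from_lower_bound[OF full_gapsD(1,2)[OF A]])
  show "(\<lambda>n. gap_length A (h n) / h n + gap_length B (h n) / h n - 1) \<longlonglongrightarrow> 1"
    using tendsto_diff[OF tendsto_add[OF full_gapsD(3)[OF A] full_gapsD(3)[OF B]]
        tendsto_const[of 1]] by simp
  show "gap_length A (h n) / h n + gap_length B (h n) / h n - 1
      \<le> gap_length (A \<union> B) (h n) / h n" for n
    using full_gapsD(1)[OF A, of n]
      divide_right_mono[OF gap_length_Un[of "h n" A B], of "h n"]
    by (simp add: add_divide_distrib diff_divide_distrib)
qed

lemma full_gaps_UN:
  assumes "finite I" "I \<noteq> {}" "\<And>i. i \<in> I \<Longrightarrow> full_gaps (A i) h"
  shows "full_gaps (\<Union>i\<in>I. A i) h"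
  using assms by (induction I rule: finite_ne_induct) (simp_all add: full_gaps_Un)

lemma upper_porosity_le_1: "upper_porosity E \<le> 1"
  unfolding upper_porosity_def
proof (rule Limsup_bounded)
  show "\<forall>\<^sub>F h in at_right 0. ereal (gap_length E h / h) \<le> 1"
    using eventually_at_right_less[of "0::real"]
    by eventually_elim (simp add: gap_length_le_scale)
qed

lemma full_gaps_imp_strongly_porous:
  assumes "full_gaps E h"
  shows "strongly_porous E"
proof -
  have at0: "filterlim h (at_right 0) sequentially"
    using full_gapsD(1,2)[OF assms] by (intro filterlim_at_withinI) auto
  have "1 \<le> upper_porosity E"
    unfolding upper_porosity_def
  proof (rule Limsup_greatest)
    fix P :: "real \<Rightarrow> bool" assume "eventually P (at_right 0)"
    with at0 have "\<forall>\<^sub>F n in sequentially. P (h n)"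
      by (simp add: filterlim_iff)
    then have "\<forall>\<^sub>F n in sequentially. ereal (gap_length E (h n) / h n)
        \<le> (SUP x\<in>Collect P. ereal (gap_length E x / x))"
      by eventually_elim (auto intro: SUP_upper)
    moreover have "(\<lambda>n. ereal (gap_length E (h n) / h n)) \<longlonglongrightarrow> 1"
      using full_gapsD(3)[OF assms] by (simp add: one_ereal_def)
    ultimately show "1 \<le> (SUP x\<in>Collect P. ereal (gap_length E x / x))"
      by (intro tendsto_upperbound) auto
  qed
  then show ?thesis
    using upper_porosity_le_1[of E] by (auto simp: strongly_porous_def)
qed

text \<open>
  If the relative gap length stayed below \<open>1 - d\<close> on \<open>(0, d)\<close>, its upper limit would be at most
  \<open>1 - d\<close>.  The same \<open>d\<close> bounds the scale and the distance to 1, so that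
  \<open>d = 1 / (n + 1)\<close> produces the whole sequence.
\<close>

lemma strongly_porous_imp_full_gaps:
  assumes "strongly_porous E"
  obtains h where "full_gaps E h"
proof -
  have "\<exists>h. 0 < h \<and> h < d \<and> 1 - d \<le> gap_length E h / h" if "0 < d" for d :: real
  proof (rule ccontr)
    assume none: "\<not> ?thesis"
    have "\<forall>\<^sub>F h in at_right 0. ereal (gap_length E h / h) \<le> ereal (1 - d)"
      using eventually_at_right_real[OF that]
      by eventually_elim (use none in \<open>force simp: not_le\<close>)
    then have "upper_porosity E \<le> ereal (1 - d)"
      unfolding upper_porosity_def by (rule Limsup_bounded)
    with assms that show False by (simp add: strongly_porous_def one_ereal_def)
  qed
  then have "\<forall>n. \<exists>h. 0 < h \<and> h < 1 / real (Suc n) \<and> 1 - 1 / real (Suc n) \<le> gap_length E h / h"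
    by (intro allI) (simp del: of_nat_Suc)
  then obtain h where h: "\<And>n. 0 < h n" "\<And>n. h n < 1 / real (Suc n)"
      "\<And>n. 1 - 1 / real (Suc n) \<le> gap_length E (h n) / h n"
    by metis
  have inverse: "(\<lambda>n. 1 / real (Suc n)) \<longlonglongrightarrow> 0"
    using LIMSEQ_inverse_real_of_nat by (simp add: inverse_eq_divide)
  have "h \<longlonglongrightarrow> 0"
    by (rule tendsto_sandwich[OF _ _ tendsto_const inverse])
       (use h in \<open>auto intro!: always_eventually less_imp_le simp del: of_nat_Suc\<close>)
  moreover have "(\<lambda>n. 1 - 1 / real (Suc n)) \<longlonglongrightarrow> 1"
    using tendsto_diff[OF tendsto_const[of 1] inverse] by simp
  ultimately show thesis
    using h that full_gaps_from_lower_bound by blast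
qed

lemma strongly_porous_iff_full_gaps: "strongly_porous E \<longleftrightarrow> (\<exists>h. full_gaps E h)"
  using full_gaps_imp_strongly_porous strongly_porous_imp_full_gaps by blast

lemma UMP_strongly_porous:
  assumes "strongly_porous E"
  shows "UMP E = {h. full_gaps E h}"
  using assms by (simp add: UMP_def strongly_porous_def full_gaps_def one_ereal_def)

theorem corollary2p10:
  fixes A :: "nat \<Rightarrow> real set" and n :: nat
  assumes "1 \<le> n"
    and "\<And>j. j \<in> {1..n} \<Longrightarrow> A j \<subseteq> {0..}"
    and "\<And>j. j \<in> {1..n} \<Longrightarrow> strongly_porous (A j)"
  shows "strongly_porous (\<Union>j\<in>{1..n}. A j) \<longleftrightarrow> coherently_porous {1..n} A"
proof -
  have "strongly_porous (\<Union>j\<in>{1..n}. A j) \<longleftrightarrow> (\<exists>h. full_gaps (\<Union>j\<in>{1..n}. A j) h)"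
    by (rule strongly_porous_iff_full_gaps)
  also have "\<dots> \<longleftrightarrow> (\<exists>h. \<forall>j\<in>{1..n}. full_gaps (A j) h)"
  proof (intro arg_cong[of _ _ Ex] ext iffI ballI)
    fix h j assume "full_gaps (\<Union>j\<in>{1..n}. A j) h" "j \<in> {1..n}"
    then show "full_gaps (A j) h" by (blast intro: full_gaps_subset)
  next
    fix h assume "\<forall>j\<in>{1..n}. full_gaps (A j) h"
    then show "full_gaps (\<Union>j\<in>{1..n}. A j) h"
      using assms(1) by (intro full_gaps_UN) auto
  qed
  also have "\<dots> \<longleftrightarrow> coherently_porous {1..n} A"
    using UMP_strongly_porous[OF assms(3)] by (auto simp: coherently_porous_def)
  finally show ?thesis .
qed

end
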